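(* Let $F$ be a finite graph with vertex set $V(F)$ and $G$ a finite graph with vertex set $V(G)$, and let $f_1,f_2:V(F)\to\mathbb{Z}_{\ge 0}$ and $g_1,g_2:V(G)\to\mathbb{Z}_{\ge 0}$ be arbitrary functions. Let $T$ be the cycle graph on $n\ge 3$ vertices $t_1,\dots,t_n$ (with edges $t_1t_2, t_2t_3,\dots,t_{n-1}t_n, t_nt_1$), and let $F$, $T$, $G$ be vertex-disjoint. For each integer $i$ with $0\le i\le n-2$ let $H_i$ be the multigraph obtained from the disjoint union $F\sqcup T\sqcup G$ by adding the following edges: (1) for each $v\in V(G)$, $g_1(v)$ edges between $v$ and $t_{n-1}$; (2) for each $v\in V(G)$, $g_2(v)$ edges between $v$ and $t_n$; (3) for each $v\in V(F)$, $f_1(v)$ edges between $v$ and $t_i$ if $1\le i\le n-2$, or between $v$ and $t_n$ if $i=0$; (4) for each $v\in V(F)$, $f_2(v)$ edges between $v$ and $t_{i+1}$. Then the sandpile group $S(H_i)$ does not depend on $i$: $S(H_i)\cong S(H_j)$ for all $0\le i,j\le n-2$.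
   Context: For a finite multigraph $X$ with Laplacian matrix $L$ (diagonal entries the vertex degrees, off-diagonal entry $(u,v)$ equal to minus the number of edges between $u$ and $v$), the sandpile group is $S(X)\cong\bigoplus_{a} C_{|a|}$, where $a$ ranges over the nonzero diagonal entries (with multiplicity) of the Smith normal form of $L$, and $C_m$ denotes the cyclic group of order $m$. *)

theory Defs
  imports
    "Jordan_Normal_Form.Matrix"
    "HOL-Algebra.Elementary_Groups"
    "HOL-Algebra.Product_Groups"
    "HOL-Library.Multiset"
begin

text \<open>A multigraph has a multiset of edges, each edge being the set of its two distinct end
  points. Loops are excluded: the Laplacian is the matrix of degrees and edge multiplicities only
  for loopless multigraphs.\<close>

record 'a mgraph =
  verts :: "'a set"
  edges :: "'a set multiset"

definition finite_multigraph :: "'a mgraph \<Rightarrow> bool" where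
  "finite_multigraph X \<longleftrightarrow>
     finite (verts X) \<and> (\<forall>e\<in>#edges X. e \<subseteq> verts X \<and> card e = 2)"

definition degree :: "'a mgraph \<Rightarrow> 'a \<Rightarrow> nat" where
  "degree X v = size {#e \<in># edges X. v \<in> e#}"

text \<open>The list \<open>vs\<close> enumerates the vertices and fixes the order of rows and columns.\<close>

definition laplacian :: "'a mgraph \<Rightarrow> 'a list \<Rightarrow> int mat" where
  "laplacian X vs = mat (length vs) (length vs) (\<lambda>(i, j).
     if i = j then int (degree X (vs ! i)) else - int (count (edges X) {vs ! i, vs ! j}))"

text \<open>\<open>D\<close> is a Smith normal form of the integer matrix \<open>A\<close>. As \<^const>\<open>invertible_mat\<close> is used at
  type \<^typ>\<open>int mat\<close>, the inverses of \<open>P\<close> and \<open>Q\<close> are integral. The diagonal entries are not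
  normalised, so they are unique only up to sign; zero entries come last since \<open>0\<close> divides only
  \<open>0\<close>.\<close>

definition smith_normal_form :: "int mat \<Rightarrow> int mat \<Rightarrow> bool" where
  "smith_normal_form A D \<longleftrightarrow>
     (\<exists>P Q. P \<in> carrier_mat (dim_row A) (dim_row A) \<and> invertible_mat P \<and>
            Q \<in> carrier_mat (dim_col A) (dim_col A) \<and> invertible_mat Q \<and>
            D = P * A * Q) \<and>
     diagonal_mat D \<and>
     (\<forall>i. Suc i < min (dim_row D) (dim_col D) \<longrightarrow> D $$ (i, i) dvd D $$ (Suc i, Suc i))"

text \<open>The direct sum of the cyclic groups of order \<open>\<bar>a\<bar>\<close>, where \<open>a\<close> ranges over the nonzero
  diagonal entries of \<open>D\<close>; indexing by position accounts for multiplicity.\<close>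

definition diagonal_group :: "int mat \<Rightarrow> (nat \<Rightarrow> int) monoid" where
  "diagonal_group D =
     sum_group {i. i < min (dim_row D) (dim_col D) \<and> D $$ (i, i) \<noteq> 0}
       (\<lambda>i. integer_mod_group (nat \<bar>D $$ (i, i)\<bar>))"

text \<open>Another vertex enumeration or another Smith normal form changes the diagonal entries at
  most by signs, so the choice of \<open>D\<close> does not affect the group.\<close>

definition sandpile_group :: "'a mgraph \<Rightarrow> (nat \<Rightarrow> int) monoid" where
  "sandpile_group X = diagonal_group
     (SOME D. \<exists>vs. distinct vs \<and> set vs = verts X \<and> smith_normal_form (laplacian X vs) D)"

definition cycle_graph :: "nat \<Rightarrow> (nat \<Rightarrow> 'a) \<Rightarrow> 'a mgraph" where
  "cycle_graph n t =
     \<lparr>verts = t ` {1..n},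
      edges = {#{t k, t (k + 1)}. k \<in># mset_set {1..<n}#} + {#{t n, t 1}#}\<rparr>"

definition join_edges :: "'a mgraph \<Rightarrow> ('a \<Rightarrow> nat) \<Rightarrow> 'a \<Rightarrow> 'a set multiset" where
  "join_edges X h x = (\<Sum>v\<in>verts X. replicate_mset (h v) {v, x})"

text \<open>The multigraph \<open>H\<^sub>i\<close>; \<open>F\<close>, \<open>G\<close> and the cycle on \<open>t 1, \<dots>, t n\<close> are meant to be pairwise
  vertex-disjoint.\<close>

definition cycle_gluing ::
  "'a mgraph \<Rightarrow> 'a mgraph \<Rightarrow> nat \<Rightarrow> (nat \<Rightarrow> 'a) \<Rightarrow>
   ('a \<Rightarrow> nat) \<Rightarrow> ('a \<Rightarrow> nat) \<Rightarrow> ('a \<Rightarrow> nat) \<Rightarrow> ('a \<Rightarrow> nat) \<Rightarrow> nat \<Rightarrow> 'a mgraph" where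
  "cycle_gluing F G n t f\<^sub>1 f\<^sub>2 g\<^sub>1 g\<^sub>2 i =
     \<lparr>verts = verts F \<union> verts (cycle_graph n t) \<union> verts G,
      edges = edges F + edges (cycle_graph n t) + edges G
        + join_edges G g\<^sub>1 (t (n - 1))
        + join_edges G g\<^sub>2 (t n)
        + join_edges F f\<^sub>1 (if i = 0 then t n else t i)
        + join_edges F f\<^sub>2 (t (i + 1))\<rparr>"

end

theory Submission
  imports Defs
begin

text \<open>The Laplacian is the Gram matrix of the Dirichlet form
  \<open>\<Sum>\<^bsub>pq\<^esub> (x p - x q) * (y p - y q)\<close>, the sum running over the edges. Let \<open>F\<close> be glued along the
  cycle edge \<open>ab\<close>, and let \<open>bc\<close> be the next edge. Replacing \<open>x b\<close> by \<open>x a + x c - x b\<close> swaps the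
  differences along \<open>ab\<close> and \<open>bc\<close>. Adding \<open>x a - x b\<close> to \<open>x\<close> on all of \<open>F\<close> then turns the
  differences along the edges joining \<open>F\<close> to \<open>a\<close> and \<open>b\<close> into those along the edges joining \<open>F\<close>
  to \<open>b\<close> and \<open>c\<close>, and keeps the differences inside \<open>F\<close>. So this unimodular substitution carries
  the form of \<open>H\<^sub>i\<close> to that of \<open>H\<^sub>i\<^sub>+\<^sub>1\<close>: the two Laplacians are congruent over the integers and have
  the same Smith normal forms.\<close>

text \<open>Symmetric in the end points, hence a function of the edge as a set; it equals
  \<open>(x p - x q) * (y p - y q)\<close> on \<open>{p, q}\<close> only for \<open>p \<noteq> q\<close>.\<close>

definition edge_form :: "('a \<Rightarrow> int) \<Rightarrow> ('a \<Rightarrow> int) \<Rightarrow> 'a set \<Rightarrow> int" where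
  "edge_form x y e = 2 * (\<Sum>v\<in>e. x v * y v) - (\<Sum>v\<in>e. x v) * (\<Sum>v\<in>e. y v)"

lemma edge_form_doubleton:
  "p \<noteq> q \<Longrightarrow> edge_form x y {p, q} = (x p - x q) * (y p - y q)"
  by (simp add: edge_form_def algebra_simps)

section \<open>The Laplacian as the Gram matrix of the Dirichlet form\<close>

definition dirichlet_form :: "'a set multiset \<Rightarrow> ('a \<Rightarrow> int) \<Rightarrow> ('a \<Rightarrow> int) \<Rightarrow> int" where
  "dirichlet_form M x y = (\<Sum>e\<in>#M. edge_form x y e)"

lemma dirichlet_form_plus:
  "dirichlet_form (M + N) x y = dirichlet_form M x y + dirichlet_form N x y"
  by (simp add: dirichlet_form_def)

lemma sum_sum_delta:
  assumes "finite A" "a \<in> A" "b \<in> A"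
  shows "(\<Sum>u\<in>A. \<Sum>v\<in>A. if u = a then if v = b then c else 0 else 0) = (c :: 'b :: comm_monoid_add)"
proof -
  have "(\<Sum>u\<in>A. \<Sum>v\<in>A. if u = a then if v = b then c else 0 else 0)
      = (\<Sum>u\<in>A. if u = a then c else 0)"
    using assms by (intro sum.cong refl) auto
  then show ?thesis
    using assms by simp
qed

text \<open>The coefficient is the Laplacian entry of the graph whose only edge is
  \<open>{p, q}\<close>. It vanishes except at the four index pairs formed from \<open>p\<close> and
  \<open>q\<close>, which yield the four terms of \<open>(x p - x q) * (y p - y q)\<close>.\<close>

lemma edge_form_eq_sum:
  assumes "finite V" "p \<in> V" "q \<in> V" "p \<noteq> q"
  shows "(\<Sum>u\<in>V. \<Sum>v\<in>V. x u * (if u = v then of_bool (u \<in> {p, q})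
            else - of_bool ({u, v} = {p, q})) * y v) = edge_form x y {p, q}"
proof -
  have "(\<Sum>u\<in>V. \<Sum>v\<in>V. x u * (if u = v then of_bool (u \<in> {p, q})
            else - of_bool ({u, v} = {p, q})) * y v)
      = (\<Sum>u\<in>V. \<Sum>v\<in>V. (if u = p then if v = p then x p * y p else 0 else 0)
           + (if u = q then if v = q then x q * y q else 0 else 0)
           - (if u = p then if v = q then x p * y q else 0 else 0)
           - (if u = q then if v = p then x q * y p else 0 else 0))"
    using assms(4) by (intro sum.cong refl) (auto simp: doubleton_eq_iff)
  also have "\<dots> = x p * y p + x q * y q - x p * y q - x q * y p"
    using assms(1-3) by (simp add: sum.distrib sum_subtractf sum_sum_delta)
  finally show ?thesis
    using assms(4) by (simp add: edge_form_doubleton algebra_simps)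
qed

text \<open>Degrees and multiplicities are additive in the edges, so each new edge adds its one-edge
  Laplacian. The vertex set stays fixed while the induction runs over the edge multiset.\<close>

lemma dirichlet_form_eq_sum:
  assumes "finite V" "\<And>e. e \<in># M \<Longrightarrow> e \<subseteq> V \<and> card e = 2"
  shows "(\<Sum>u\<in>V. \<Sum>v\<in>V. x u * (if u = v then int (size {#e \<in># M. u \<in> e#})
            else - int (count M {u, v})) * y v) = dirichlet_form M x y"
  using assms(2)
proof (induction M)
  case empty
  then show ?case by (simp add: dirichlet_form_def cong: if_cong)
next
  case (add e M)
  obtain p q where e: "e = {p, q}" "p \<noteq> q"
    using add.prems[of e] by (auto simp: card_2_iff)
  then have pq: "p \<in> V" "q \<in> V"
    using add.prems[of e] by auto
  have "x u * (if u = v then int (size {#d \<in># add_mset e M. u \<in> d#})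
            else - int (count (add_mset e M) {u, v})) * y v
      = x u * (if u = v then of_bool (u \<in> {p, q}) else - of_bool ({u, v} = {p, q})) * y v
      + x u * (if u = v then int (size {#d \<in># M. u \<in> d#}) else - int (count M {u, v})) * y v"
    for u v
    by (cases "u = v") (simp_all add: e(1) algebra_simps)
  then show ?case
    using add edge_form_eq_sum[OF assms(1) pq e(2), of x y]
    by (simp add: sum.distrib dirichlet_form_def e)
qed

lemma sum_nth_distinct:
  "distinct vs \<Longrightarrow> (\<Sum>k<length vs. f (vs ! k)) = (\<Sum>v\<in>set vs. f v)"
  by (rule sum.reindex_bij_betw[OF bij_betw_nth]) auto

lemma laplacian_form:
  assumes "finite_multigraph X" "distinct vs" "set vs = verts X"
  shows "(\<Sum>k<length vs. \<Sum>l<length vs. x (vs ! k) * laplacian X vs $$ (k, l) * y (vs ! l))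
       = dirichlet_form (edges X) x y"
proof -
  define h where "h u v = x u * (if u = v then int (degree X u)
    else - int (count (edges X) {u, v})) * y v" for u v
  have "(\<Sum>k<length vs. \<Sum>l<length vs. x (vs ! k) * laplacian X vs $$ (k, l) * y (vs ! l))
      = (\<Sum>k<length vs. \<Sum>l<length vs. h (vs ! k) (vs ! l))"
    using assms(2)
    by (intro sum.cong refl) (auto simp: laplacian_def nth_eq_iff_index_eq h_def)
  also have "\<dots> = (\<Sum>k<length vs. \<Sum>v\<in>set vs. h (vs ! k) v)"
    by (intro sum.cong refl sum_nth_distinct assms(2))
  also have "\<dots> = (\<Sum>u\<in>set vs. \<Sum>v\<in>set vs. h u v)"
    by (rule sum_nth_distinct[OF assms(2)])
  also have "\<dots> = dirichlet_form (edges X) x y"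
    unfolding h_def degree_def assms(3)
    using assms(1) by (intro dirichlet_form_eq_sum) (auto simp: finite_multigraph_def)
  finally show ?thesis .
qed

section \<open>The unimodular substitution and its matrix\<close>

definition shift_values :: "'a set \<Rightarrow> 'a \<Rightarrow> 'a \<Rightarrow> 'a \<Rightarrow> ('a \<Rightarrow> int) \<Rightarrow> 'a \<Rightarrow> int" where
  "shift_values W a b c x v =
     (if v = b then x a + x c - x b else if v \<in> W then x v + x a - x b else x v)"

text \<open>Exchanging \<open>a\<close> and \<open>c\<close> inverts the substitution. The
  reflection at \<open>b\<close> is an involution symmetric in \<open>a\<close> and
  \<open>c\<close>. On \<open>W\<close> the inner map adds \<open>x c - x b\<close>; the outer one,
  reading the reflected value at \<open>b\<close>, adds \<open>x b - x c\<close>.\<close>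

lemma shift_values_inverse:
  assumes "a \<noteq> b" "c \<noteq> b" "a \<notin> W" "b \<notin> W" "c \<notin> W"
  shows "shift_values W a b c (shift_values W c b a x) = x"
  using assms by (auto simp: shift_values_def fun_eq_iff)

definition shift_mat :: "'a list \<Rightarrow> 'a set \<Rightarrow> 'a \<Rightarrow> 'a \<Rightarrow> 'a \<Rightarrow> int mat" where
  "shift_mat vs W a b c = mat (length vs) (length vs)
     (\<lambda>(r, s). shift_values W a b c (\<lambda>v. of_bool (v = vs ! s)) (vs ! r))"

lemma shift_mat_carrier [simp]: "shift_mat vs W a b c \<in> carrier_mat (length vs) (length vs)"
  by (simp add: shift_mat_def)

lemma sum_of_bool_nth:
  assumes "distinct vs" "v \<in> set vs"
  shows "(\<Sum>k<length vs. of_bool (v = vs ! k) * x (vs ! k)) = (x v :: int)"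
proof -
  have "(\<Sum>k<length vs. of_bool (v = vs ! k) * x (vs ! k)) = (\<Sum>u\<in>set vs. of_bool (v = u) * x u)"
    by (rule sum_nth_distinct[OF assms(1)])
  also have "\<dots> = (\<Sum>u\<in>set vs. if v = u then x u else 0)"
    by (intro sum.cong refl) auto
  finally show ?thesis
    using assms(2) by simp
qed

text \<open>The substitution is linear, hence determined by the images of the indicator functions,
  which are the columns of \<open>shift_mat\<close>. The vertices \<open>a\<close>,
  \<open>b\<close>, \<open>c\<close> must be listed because their values enter the results at
  \<open>b\<close> and on \<open>W\<close>.\<close>

lemma shift_values_eq_sum:
  assumes "distinct vs" "a \<in> set vs" "b \<in> set vs" "c \<in> set vs" "v \<in> set vs"
  shows "(\<Sum>k<length vs. shift_values W a b c (\<lambda>u. of_bool (u = vs ! k)) v * x (vs ! k))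
       = shift_values W a b c x v"
  using assms
  by (cases "v = b"; cases "v \<in> W")
    (simp_all add: shift_values_def distrib_right left_diff_distrib sum.distrib sum_subtractf
      sum_of_bool_nth del: sum_of_bool_mult_eq sum_mult_of_bool_eq)

text \<open>The hypotheses are symmetric in \<open>a\<close> and \<open>c\<close>, so a second
  instance gives the product in the other order.\<close>

lemma shift_mat_inverse:
  assumes "distinct vs" "a \<in> set vs" "b \<in> set vs" "c \<in> set vs"
    and "a \<noteq> b" "c \<noteq> b" "a \<notin> W" "b \<notin> W" "c \<notin> W"
  shows "shift_mat vs W a b c * shift_mat vs W c b a = 1\<^sub>m (length vs)"
proof (rule eq_matI)
  fix r s assume rs: "r < dim_row (1\<^sub>m (length vs) :: int mat)" "s < dim_col (1\<^sub>m (length vs) :: int mat)"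
  let ?\<delta> = "\<lambda>u. of_bool (u = vs ! s) :: int"
  have "(shift_mat vs W a b c * shift_mat vs W c b a) $$ (r, s)
     = (\<Sum>k<length vs. shift_values W a b c (\<lambda>u. of_bool (u = vs ! k)) (vs ! r)
          * shift_values W c b a ?\<delta> (vs ! k))"
    using rs by (simp add: shift_mat_def scalar_prod_def lessThan_atLeast0)
  also have "\<dots> = shift_values W a b c (shift_values W c b a ?\<delta>) (vs ! r)"
    using rs assms(1-4) by (intro shift_values_eq_sum) auto
  also have "\<dots> = 1\<^sub>m (length vs) $$ (r, s)"
    using rs assms by (auto simp: shift_values_inverse nth_eq_iff_index_eq)
  finally show "(shift_mat vs W a b c * shift_mat vs W c b a) $$ (r, s) = 1\<^sub>m (length vs) $$ (r, s)" .
qed (auto simp: shift_mat_def)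

section \<open>Congruent Laplacians and their Smith normal forms\<close>

lemma congruence_index:
  fixes A S :: "int mat"
  assumes "A \<in> carrier_mat N N" "S \<in> carrier_mat N N" "r < N" "s < N"
  shows "(S\<^sup>T * A * S) $$ (r, s) = (\<Sum>k<N. \<Sum>l<N. S $$ (k, r) * A $$ (k, l) * S $$ (l, s))"
proof -
  have "(S\<^sup>T * A * S) $$ (r, s) = (\<Sum>k<N. S $$ (k, r) * (\<Sum>l<N. A $$ (k, l) * S $$ (l, s)))"
    using assms by (simp add: scalar_prod_def lessThan_atLeast0)
  also have "\<dots> = (\<Sum>k<N. \<Sum>l<N. S $$ (k, r) * A $$ (k, l) * S $$ (l, s))"
    by (simp add: sum_distrib_left mult.assoc)
  finally show ?thesis .
qed

text \<open>A matrix entry is the value of the bilinear form at two indicator functions, and the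
  columns of \<open>shift_mat\<close> are the shifted indicators. An identity between the forms thus
  becomes a congruence of the matrices.\<close>

lemma laplacian_congruence:
  assumes X: "finite_multigraph X" and Y: "finite_multigraph Y"
    and vs: "distinct vs" "set vs = verts X" "set vs = verts Y"
    and form: "\<And>x y. dirichlet_form (edges Y) x y
      = dirichlet_form (edges X) (shift_values W a b c x) (shift_values W a b c y)"
  shows "laplacian Y vs = (shift_mat vs W a b c)\<^sup>T * laplacian X vs * shift_mat vs W a b c"
    (is "?L = ?R")
proof (rule eq_matI)
  let ?N = "length vs" and ?\<delta> = "\<lambda>s v. of_bool (v = vs ! s) :: int"
  fix r s assume "r < dim_row ?R" "s < dim_col ?R"
  then have rs: "r < ?N" "s < ?N" by (auto simp: shift_mat_def)
  have "?R $$ (r, s) = (\<Sum>k<?N. \<Sum>l<?N. shift_values W a b c (?\<delta> r) (vs ! k)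
      * laplacian X vs $$ (k, l) * shift_values W a b c (?\<delta> s) (vs ! l))"
    using rs by (subst congruence_index[where N = ?N]) (auto simp: laplacian_def shift_mat_def)
  also have "\<dots> = (\<Sum>k<?N. \<Sum>l<?N. ?\<delta> r (vs ! k) * laplacian Y vs $$ (k, l) * ?\<delta> s (vs ! l))"
    unfolding laplacian_form[OF X vs(1,2)] form[symmetric]
    by (rule laplacian_form[OF Y vs(1,3), symmetric])
  also have "\<dots> = (\<Sum>k<?N. \<Sum>l<?N. if k = r then if l = s then ?L $$ (r, s) else 0 else 0)"
    using rs vs(1) by (intro sum.cong refl) (auto simp: nth_eq_iff_index_eq)
  also have "\<dots> = ?L $$ (r, s)"
    using rs by (intro sum_sum_delta) auto
  finally show "?L $$ (r, s) = ?R $$ (r, s)" by simp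
qed (auto simp: laplacian_def shift_mat_def)

lemma invertible_matI:
  assumes "A \<in> carrier_mat N N" "B \<in> carrier_mat N N" "A * B = 1\<^sub>m N" "B * A = 1\<^sub>m N"
  shows "invertible_mat A"
  using assms by (auto simp: invertible_mat_def inverts_mat_def)

lemma invertible_mat_mult:
  fixes A B :: "'b::comm_ring_1 mat"
  assumes A: "A \<in> carrier_mat N N" "invertible_mat A" and B: "B \<in> carrier_mat N N" "invertible_mat B"
  shows "invertible_mat (A * B)"
proof -
  have inverse: "\<exists>C' \<in> carrier_mat N N. C * C' = 1\<^sub>m N \<and> C' * C = 1\<^sub>m N"
    if C: "C \<in> carrier_mat N N" "invertible_mat C" for C :: "'b mat"
  proof -
    obtain C' where C': "C * C' = 1\<^sub>m N" "C' * C = 1\<^sub>m (dim_row C')"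
      using C by (auto simp: invertible_mat_def inverts_mat_def)
    \<comment> \<open>\<open>inverts_mat\<close> does not prescribe the size of the inverse: the
      first product fixes its number of columns, the second its number of rows.\<close>
    then have "C' \<in> carrier_mat N N"
      using C(1) by (metis carrier_matD(2) carrier_matI index_mult_mat(3) index_one_mat(3))
    then show ?thesis using C' by auto
  qed
  obtain A' where A': "A' \<in> carrier_mat N N" "A * A' = 1\<^sub>m N" "A' * A = 1\<^sub>m N"
    using inverse[OF A] by blast
  obtain B' where B': "B' \<in> carrier_mat N N" "B * B' = 1\<^sub>m N" "B' * B = 1\<^sub>m N"
    using inverse[OF B] by blast
  have "A * B * (B' * A') = A * (B * B') * A'"
    using A(1) B(1) A'(1) B'(1) by (simp add: assoc_mult_mat[of _ N N _ N _ N])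
  also have "\<dots> = 1\<^sub>m N"
    unfolding B' using A A' by simp
  finally have AB: "A * B * (B' * A') = 1\<^sub>m N" .
  have "B' * A' * (A * B) = B' * (A' * A) * B"
    using A(1) B(1) A'(1) B'(1) by (simp add: assoc_mult_mat[of _ N N _ N _ N])
  also have "\<dots> = 1\<^sub>m N"
    unfolding A' using B B' by simp
  finally have BA: "B' * A' * (A * B) = 1\<^sub>m N" .
  show ?thesis
    using A B A' B' by (intro invertible_matI[OF _ _ AB BA]) auto
qed

text \<open>The factors \<open>U\<close> and \<open>V\<close> are absorbed into the transforming
  matrices. As \<open>D\<close> is unchanged, diagonality and divisibility carry over.\<close>

lemma smith_normal_form_equivalent:
  assumes A: "A \<in> carrier_mat N N"
    and U: "U \<in> carrier_mat N N" "invertible_mat U"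
    and V: "V \<in> carrier_mat N N" "invertible_mat V"
    and snf: "smith_normal_form (U * A * V) D"
  shows "smith_normal_form A D"
proof -
  obtain P Q where P: "P \<in> carrier_mat N N" "invertible_mat P"
    and Q: "Q \<in> carrier_mat N N" "invertible_mat Q" and D: "D = P * (U * A * V) * Q"
    using snf U V unfolding smith_normal_form_def by auto
  have "D = (P * U) * A * (V * Q)"
    using A U V P Q D by (simp add: assoc_mult_mat[of _ N N _ N _ N])
  moreover have "P * U \<in> carrier_mat N N" "V * Q \<in> carrier_mat N N"
    "invertible_mat (P * U)" "invertible_mat (V * Q)"
    using U V P Q invertible_mat_mult by auto
  ultimately show ?thesis
    using snf A unfolding smith_normal_form_def carrier_matD[OF A] by blast
qed

text \<open>Congruence by \<open>S\<close> is an equivalence with the unimodular factors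
  \<open>S\<^sup>T\<close> and \<open>S\<close>; congruence by \<open>T\<close> undoes it, which
  gives the converse.\<close>

lemma smith_normal_form_congruent:
  assumes A: "A \<in> carrier_mat N N" and S: "S \<in> carrier_mat N N" and T: "T \<in> carrier_mat N N"
    and ST: "S * T = 1\<^sub>m N" "T * S = 1\<^sub>m N"
  shows "smith_normal_form (S\<^sup>T * A * S) D \<longleftrightarrow> smith_normal_form A D"
proof -
  have TS': "T\<^sup>T * S\<^sup>T = 1\<^sub>m N" "S\<^sup>T * T\<^sup>T = 1\<^sub>m N"
    using ST S T by (metis transpose_mult transpose_one)+
  have inv: "invertible_mat S" "invertible_mat T" "invertible_mat (S\<^sup>T)" "invertible_mat (T\<^sup>T)"
    using S T
    by (auto intro: invertible_matI[OF _ _ ST] invertible_matI[OF _ _ ST(2,1)]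
        invertible_matI[OF _ _ TS'] invertible_matI[OF _ _ TS'(2,1)])
  have "A = (T\<^sup>T * S\<^sup>T) * A * (S * T)"
    unfolding ST TS' using A by simp
  also have "\<dots> = T\<^sup>T * (S\<^sup>T * A * S) * T"
    using A S T by (simp add: assoc_mult_mat[of _ N N _ N _ N])
  finally have A_eq: "A = T\<^sup>T * (S\<^sup>T * A * S) * T" .
  show ?thesis
  proof
    assume "smith_normal_form (S\<^sup>T * A * S) D"
    then show "smith_normal_form A D"
      by (rule smith_normal_form_equivalent[rotated -1]) (use A S inv in auto)
  next
    assume "smith_normal_form A D"
    then have "smith_normal_form (T\<^sup>T * (S\<^sup>T * A * S) * T) D"
      unfolding A_eq[symmetric] .
    then show "smith_normal_form (S\<^sup>T * A * S) D"
      by (rule smith_normal_form_equivalent[rotated -1]) (use A S T inv in auto)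
  qed
qed

section \<open>The glued graphs, their Dirichlet forms and their sandpile groups\<close>

lemma dirichlet_form_cong:
  assumes "\<And>e. e \<in># M \<Longrightarrow> edge_form x y e = edge_form x' y' e"
  shows "dirichlet_form M x y = dirichlet_form M x' y'"
  unfolding dirichlet_form_def using assms by (simp cong: image_mset_cong)

lemma dirichlet_form_join_edges:
  assumes "finite (verts X)" "p \<notin> verts X"
  shows "dirichlet_form (join_edges X h p) x y
       = (\<Sum>v\<in>verts X. int (h v) * ((x v - x p) * (y v - y p)))"
proof -
  \<comment> \<open>The vertex set becomes a variable to allow induction over it; \<open>p\<close>
    outside it keeps every \<open>{v, p}\<close> a genuine edge.\<close>
  have "dirichlet_form (\<Sum>v\<in>V. replicate_mset (h v) {v, p}) x y
      = (\<Sum>v\<in>V. int (h v) * ((x v - x p) * (y v - y p)))" if "finite V" "p \<notin> V" for V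
    using that
  proof (induction V)
    case (insert v V)
    then have "edge_form x y {v, p} = (x v - x p) * (y v - y p)"
      by (intro edge_form_doubleton) auto
    then show ?case
      using insert by (simp add: dirichlet_form_def)
  qed (simp add: dirichlet_form_def)
  then show ?thesis
    using assms by (simp add: join_edges_def)
qed

context
  fixes F G :: "'a mgraph"
    and f\<^sub>1 f\<^sub>2 g\<^sub>1 g\<^sub>2 :: "'a \<Rightarrow> nat"
    and n :: nat
    and t :: "nat \<Rightarrow> 'a"
  assumes F: "finite_multigraph F"
    and G: "finite_multigraph G"
    and n: "n \<ge> 3"
    and inj: "inj_on t {1..n}"
    and FG: "verts F \<inter> verts G = {}"
    and FT: "verts F \<inter> verts (cycle_graph n t) = {}"
    and GT: "verts G \<inter> verts (cycle_graph n t) = {}"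
begin

text \<open>With index 0 read as \<open>n\<close>, cycle edge number \<open>k\<close> joins
  \<open>cyc k\<close> to \<open>t (Suc k)\<close> for every \<open>k < n\<close>, and
  \<open>H i\<close> glues \<open>F\<close> along edge number \<open>i\<close>.\<close>

private abbreviation (input) cyc :: "nat \<Rightarrow> 'a" where
  "cyc k \<equiv> if k = 0 then t n else t k"

private abbreviation (input) H :: "nat \<Rightarrow> 'a mgraph" where
  "H \<equiv> cycle_gluing F G n t f\<^sub>1 f\<^sub>2 g\<^sub>1 g\<^sub>2"

private lemma t_eq_iff: "k \<in> {1..n} \<Longrightarrow> l \<in> {1..n} \<Longrightarrow> t k = t l \<longleftrightarrow> k = l"
  by (rule inj_on_eq_iff[OF inj])

private lemma t_notin: "k \<in> {1..n} \<Longrightarrow> t k \<notin> verts F" "k \<in> {1..n} \<Longrightarrow> t k \<notin> verts G"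
  using FT GT by (auto simp: cycle_graph_def)

private lemma dirichlet_form_cycle:
  "dirichlet_form (edges (cycle_graph n t)) x y
     = (\<Sum>k<n. (x (cyc k) - x (t (Suc k))) * (y (cyc k) - y (t (Suc k))))"
proof -
  have "dirichlet_form (edges (cycle_graph n t)) x y
      = edge_form x y {t n, t 1} + (\<Sum>k\<in>{1..<n}. edge_form x y {t k, t (Suc k)})"
    by (simp add: dirichlet_form_def cycle_graph_def image_mset.compositionality comp_def
        sum_unfold_sum_mset)
  \<comment> \<open>The closing edge \<open>{t n, t 1}\<close> becomes the summand for
    \<open>k = 0\<close>.\<close>
  also have "\<dots> = (\<Sum>k<n. edge_form x y {cyc k, t (Suc k)})"
    using n by (simp add: lessThan_atLeast0 sum.atLeast_Suc_lessThan)
  also have "\<dots> = (\<Sum>k<n. (x (cyc k) - x (t (Suc k))) * (y (cyc k) - y (t (Suc k))))"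
    using n by (intro sum.cong refl edge_form_doubleton) (auto simp: t_eq_iff)
  finally show ?thesis .
qed

private lemma finite_multigraph_gluing:
  assumes "i \<le> n - 2"
  shows "finite_multigraph (H i)"
proof -
  have join: "e \<subseteq> insert p (verts X) \<and> card e = 2"
    if e: "e \<in># join_edges X h p" "finite (verts X)" "p \<notin> verts X" for e p h and X :: "'a mgraph"
  proof -
    obtain v where "v \<in> verts X" "e = {v, p}"
      using e by (auto simp: join_edges_def set_mset_sum split: if_splits)
    then show ?thesis using that(3) by (cases "v = p") auto
  qed
  have fin: "finite (verts F)" "finite (verts G)"
    using F G by (auto simp: finite_multigraph_def)
  have cyc: "e \<subseteq> t ` {1..n} \<and> card e = 2" if "e \<in># edges (cycle_graph n t)" for e
  proof -
    have "(\<exists>k\<in>{1..<n}. e = {t k, t (Suc k)}) \<or> e = {t n, t 1}"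
      using that by (auto simp: cycle_graph_def)
    then obtain k l where "k \<in> {1..n}" "l \<in> {1..n}" "k \<noteq> l" "e = {t k, t l}"
    proof
      assume "\<exists>k\<in>{1..<n}. e = {t k, t (Suc k)}"
      then obtain k where "k \<in> {1..<n}" "e = {t k, t (Suc k)}" by blast
      then show thesis by (intro that[of k "Suc k"]) auto
    next
      assume "e = {t n, t 1}"
      then show thesis using n by (intro that[of n 1]) auto
    qed
    then show ?thesis by (simp add: t_eq_iff)
  qed
  have mem: "t (n - 1) \<in> t ` {1..n}" "t n \<in> t ` {1..n}" "cyc i \<in> t ` {1..n}" "t (Suc i) \<in> t ` {1..n}"
    using n assms by auto
  have notin: "t (n - 1) \<notin> verts G" "t n \<notin> verts G" "cyc i \<notin> verts F" "t (Suc i) \<notin> verts F"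
    using n assms t_notin by auto
  have "e \<subseteq> verts F \<union> t ` {1..n} \<union> verts G \<and> card e = 2" if "e \<in># edges (H i)" for e
  proof -
    have "e \<in># edges F \<or> e \<in># edges (cycle_graph n t) \<or> e \<in># edges G
      \<or> e \<in># join_edges G g\<^sub>1 (t (n - 1)) \<or> e \<in># join_edges G g\<^sub>2 (t n)
      \<or> e \<in># join_edges F f\<^sub>1 (cyc i) \<or> e \<in># join_edges F f\<^sub>2 (t (Suc i))"
      using that by (auto simp: cycle_gluing_def)
    then show ?thesis
    proof (elim disjE)
      assume "e \<in># edges F" then show ?thesis using F by (auto simp: finite_multigraph_def)
    next
      assume "e \<in># edges G" then show ?thesis using G by (auto simp: finite_multigraph_def)
    next
      assume "e \<in># edges (cycle_graph n t)" then show ?thesis using cyc by blast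
    next
      assume "e \<in># join_edges G g\<^sub>1 (t (n - 1))" then show ?thesis using join fin mem notin by blast
    next
      assume "e \<in># join_edges G g\<^sub>2 (t n)" then show ?thesis using join fin mem notin by blast
    next
      assume "e \<in># join_edges F f\<^sub>1 (cyc i)" then show ?thesis using join[OF _ fin(1) notin(3)] mem(3) by blast
    next
      assume "e \<in># join_edges F f\<^sub>2 (t (Suc i))" then show ?thesis using join fin mem notin by blast
    qed
  qed
  then show ?thesis
    using fin by (auto simp: finite_multigraph_def cycle_gluing_def cycle_graph_def)
qed

text \<open>The forms are compared one group of edges at a time. Only \<open>t (Suc i)\<close> and
  the vertices of \<open>F\<close> change value; the bound on \<open>i\<close> keeps
  \<open>t (Suc i)\<close> distinct from \<open>t (n - 1)\<close> and \<open>t n\<close>, so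
  everything attached to \<open>G\<close> is unaffected.\<close>

private lemma dirichlet_form_gluing_Suc:
  assumes i: "Suc i \<le> n - 2"
  defines "\<sigma> \<equiv> shift_values (verts F) (cyc i) (t (Suc i)) (t (Suc (Suc i)))"
  shows "dirichlet_form (edges (H (Suc i))) x y = dirichlet_form (edges (H i)) (\<sigma> x) (\<sigma> y)"
proof -
  have fin: "finite (verts F)" "finite (verts G)"
    using F G by (auto simp: finite_multigraph_def)
  have notin: "t (n - 1) \<notin> verts G" "t n \<notin> verts G" "cyc i \<notin> verts F" "t (Suc i) \<notin> verts F"
      "t (Suc (Suc i)) \<notin> verts F" "t (Suc i) \<notin> verts G" "t (n - 1) \<notin> verts F" "t n \<notin> verts F"
    using n i t_notin by auto
  have \<sigma>_t: "\<sigma> z (t k) = (if k = Suc i then z (cyc i) + z (t (Suc (Suc i))) - z (t (Suc i)) else z (t k))"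
    if "k \<in> {1..n}" for z k
    using that i n t_notin by (auto simp: \<sigma>_def shift_values_def t_eq_iff)
  have \<sigma>_cyc: "\<sigma> z (cyc k) = (if k = Suc i then z (cyc i) + z (t (Suc (Suc i))) - z (t (Suc i)) else z (cyc k))"
    if "k < n" for z k
    using that i n \<sigma>_t[of k z] \<sigma>_t[of n z] by auto
  have \<sigma>_F: "\<sigma> z v = z v + z (cyc i) - z (t (Suc i))" if "v \<in> verts F" for z v
    using that notin by (auto simp: \<sigma>_def shift_values_def)
  have \<sigma>_G: "\<sigma> z v = z v" if "v \<in> verts G" for z v
    using that notin FG by (auto simp: \<sigma>_def shift_values_def)
  have "dirichlet_form (edges F) x y = dirichlet_form (edges F) (\<sigma> x) (\<sigma> y)"
  proof (rule dirichlet_form_cong)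
    fix e assume "e \<in># edges F"
    then obtain p q where "e = {p, q}" "p \<noteq> q" "p \<in> verts F" "q \<in> verts F"
      using F by (fastforce simp: finite_multigraph_def card_2_iff)
    then show "edge_form x y e = edge_form (\<sigma> x) (\<sigma> y) e"
      by (simp add: edge_form_doubleton \<sigma>_F)
  qed
  moreover have "dirichlet_form (edges G) x y = dirichlet_form (edges G) (\<sigma> x) (\<sigma> y)"
  proof (rule dirichlet_form_cong)
    fix e assume "e \<in># edges G"
    then obtain p q where "e = {p, q}" "p \<noteq> q" "p \<in> verts G" "q \<in> verts G"
      using G by (fastforce simp: finite_multigraph_def card_2_iff)
    then show "edge_form x y e = edge_form (\<sigma> x) (\<sigma> y) e"
      by (simp add: edge_form_doubleton \<sigma>_G)
  qed
  moreover have "dirichlet_form (edges (cycle_graph n t)) x y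
      = dirichlet_form (edges (cycle_graph n t)) (\<sigma> x) (\<sigma> y)"
  proof -
    \<comment> \<open>The difference along cycle edge \<open>k\<close>. Only the edges
      \<open>i\<close> and \<open>Suc i\<close> meet the reflected vertex, and their differences are
      exchanged, so the sum over the cycle is preserved.\<close>
    define d where "d = (\<lambda>z k. z (cyc k) - z (t (Suc k)) :: int)"
    let ?R = "{..<n} - {i, Suc i}"
    have split: "(\<Sum>k<n. h k) = h i + h (Suc i) + (\<Sum>k\<in>?R. h k)" for h :: "nat \<Rightarrow> int"
    proof -
      have "sum h {i, Suc i} + sum h ?R = sum h {..<n}"
        using i n by (subst sum.union_disjoint[symmetric]) (auto intro!: arg_cong[of _ _ "sum h"])
      then show ?thesis by simp
    qed
    have "d (\<sigma> z) i = d z (Suc i)" "d (\<sigma> z) (Suc i) = d z i" for z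
      using i n \<sigma>_cyc[of i z] \<sigma>_cyc[of "Suc i" z] \<sigma>_t[of "Suc i" z] \<sigma>_t[of "Suc (Suc i)" z]
      by (auto simp: d_def)
    moreover have "d (\<sigma> z) k = d z k" if "k \<in> ?R" for z k
      using that i n \<sigma>_cyc[of k z] \<sigma>_t[of "Suc k" z] by (auto simp: d_def)
    ultimately have "(\<Sum>k<n. d x k * d y k) = (\<Sum>k<n. d (\<sigma> x) k * d (\<sigma> y) k)"
      unfolding split by simp
    then show ?thesis
      unfolding dirichlet_form_cycle d_def .
  qed
  moreover have "dirichlet_form (join_edges G g\<^sub>1 (t (n - 1))) x y
      = dirichlet_form (join_edges G g\<^sub>1 (t (n - 1))) (\<sigma> x) (\<sigma> y)"
    using fin notin i n by (simp add: dirichlet_form_join_edges \<sigma>_G \<sigma>_t)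
  moreover have "dirichlet_form (join_edges G g\<^sub>2 (t n)) x y
      = dirichlet_form (join_edges G g\<^sub>2 (t n)) (\<sigma> x) (\<sigma> y)"
    using fin notin i n by (simp add: dirichlet_form_join_edges \<sigma>_G \<sigma>_t)
  \<comment> \<open>For \<open>v\<close> in \<open>F\<close>, the added \<open>x (cyc i)\<close>
    cancels: \<open>\<sigma> x v - \<sigma> x (cyc i) = x v - x (t (Suc i))\<close>.\<close>
  moreover have "dirichlet_form (join_edges F f\<^sub>1 (t (Suc i))) x y
      = dirichlet_form (join_edges F f\<^sub>1 (cyc i)) (\<sigma> x) (\<sigma> y)"
    using i n \<sigma>_cyc[of i]
    by (simp only: dirichlet_form_join_edges[OF fin(1)] notin not_False_eq_True) (simp add: \<sigma>_F)
  \<comment> \<open>Here the reflected value is subtracted: \<open>\<sigma> x v - \<sigma> x (t (Suc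
    i)) = x v - x (t (Suc (Suc i)))\<close>.\<close>
  moreover have "dirichlet_form (join_edges F f\<^sub>2 (t (Suc (Suc i)))) x y
      = dirichlet_form (join_edges F f\<^sub>2 (t (Suc i))) (\<sigma> x) (\<sigma> y)"
    using fin notin i n by (simp add: dirichlet_form_join_edges \<sigma>_F \<sigma>_t algebra_simps)
  ultimately show ?thesis
    by (simp add: cycle_gluing_def dirichlet_form_plus)
qed

text \<open>An equivalence for every \<open>D\<close> and every enumeration is required, since the
  choice in \<open>sandpile_group\<close> ranges over both.\<close>

private lemma smith_normal_form_gluing_Suc:
  assumes i: "Suc i \<le> n - 2" and vs: "distinct vs" "set vs = verts (H i)"
  shows "smith_normal_form (laplacian (H (Suc i)) vs) D \<longleftrightarrow> smith_normal_form (laplacian (H i) vs) D"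
proof -
  let ?a = "cyc i" and ?b = "t (Suc i)" and ?c = "t (Suc (Suc i))"
  have V: "verts (H k) = verts F \<union> t ` {1..n} \<union> verts G" for k
    by (simp add: cycle_gluing_def cycle_graph_def)
  have mem: "?a \<in> set vs" "?b \<in> set vs" "?c \<in> set vs"
    using i n by (auto simp: vs V)
  have neq: "?a \<noteq> ?b" "?c \<noteq> ?b"
    using i n by (auto simp: t_eq_iff)
  have notin: "?a \<notin> verts F" "?b \<notin> verts F" "?c \<notin> verts F"
    using i n t_notin by auto
  have "laplacian (H (Suc i)) vs = (shift_mat vs (verts F) ?a ?b ?c)\<^sup>T * laplacian (H i) vs
      * shift_mat vs (verts F) ?a ?b ?c"
    using i vs dirichlet_form_gluing_Suc[OF i]
    by (intro laplacian_congruence finite_multigraph_gluing) (auto simp: V)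
  moreover have "laplacian (H i) vs \<in> carrier_mat (length vs) (length vs)"
    by (simp add: laplacian_def)
  ultimately show ?thesis
    using shift_mat_inverse[OF vs(1) mem neq notin]
      shift_mat_inverse[OF vs(1) mem(3,2,1) neq(2,1) notin(3,2,1)]
    by (simp add: smith_normal_form_congruent[OF _ shift_mat_carrier shift_mat_carrier])
qed

text \<open>Equality, not only isomorphism: both choices of a Smith normal form are made from the same
  set of matrices.\<close>

lemma sandpile_group_gluing:
  "i \<le> n - 2 \<Longrightarrow> sandpile_group (H i) = sandpile_group (H 0)"
proof (induction i)
  case (Suc i)
  have "verts (H (Suc i)) = verts (H i)"
    by (simp add: cycle_gluing_def)
  then have "sandpile_group (H (Suc i)) = sandpile_group (H i)"
    unfolding sandpile_group_def
    using smith_normal_form_gluing_Suc[OF Suc.prems] by (metis (no_types, lifting))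
  then show ?case using Suc by simp
qed simp

end

theorem theorem1:
  fixes F G :: "'a mgraph"
    and f\<^sub>1 f\<^sub>2 g\<^sub>1 g\<^sub>2 :: "'a \<Rightarrow> nat"
    and n :: nat
    and t :: "nat \<Rightarrow> 'a"
    and i j :: nat
  assumes "finite_multigraph F"
    and "finite_multigraph G"
    and "n \<ge> 3"
    and "inj_on t {1..n}"
    and "verts F \<inter> verts G = {}"
    and "verts F \<inter> verts (cycle_graph n t) = {}"
    and "verts G \<inter> verts (cycle_graph n t) = {}"
    and "i \<le> n - 2"
    and "j \<le> n - 2"
  shows "sandpile_group (cycle_gluing F G n t f\<^sub>1 f\<^sub>2 g\<^sub>1 g\<^sub>2 i)
       \<cong> sandpile_group (cycle_gluing F G n t f\<^sub>1 f\<^sub>2 g\<^sub>1 g\<^sub>2 j)"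
  using sandpile_group_gluing[OF assms(1-7), of i] sandpile_group_gluing[OF assms(1-7), of j]
    assms(8,9) by simp

end
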